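(* Let $\xi$ be an invariant random measure on $\mathbb{G}$ and let $\eta$ be a simple invariant point process on $\mathbb{G}$. Let $\tau$ be an allocation such that, for $\mathbb{P}$-a.e. $\omega$, $\tau(\omega,s)\in \operatorname{supp}\eta(\omega)\cup\{\infty\}$ for $\xi(\omega)$-a.e. $s\in\mathbb{G}$. Let $h\colon\Omega\times\Omega\to[0,\infty]$ be measurable. Then $$\int \mathbf 1\{\tau(\omega,0)\neq\infty\}\,h(\omega,\theta_{\tau(\omega,0)}\omega)\,\mathbb{P}_\xi(d\omega)=\int\int_{C_\tau(\omega,0)}h(\theta_s\omega,\omega)\,\xi(\omega,ds)\,\mathbb{P}_\eta(d\omega),$$ where $C_\tau(\omega,0):=\{t\in\mathbb{G}:\tau(\omega,t)=0\}$, and $\mathbb{P}_\xi$, $\mathbb{P}_\eta$ are the Palm measures of $\xi$ and $\eta$ with respect to $\mathbb{P}$.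
   Context: $\mathbb{G}$ is a second countable locally compact Hausdorff Abelian group (written additively, neutral element $0$) with Borel $\sigma$-field $\mathcal{G}$ and non-trivial Haar measure $\lambda$. $(\Omega,\mathcal{A})$ is a measurable space with a measurable flow $\{\theta_s:s\in\mathbb{G}\}$: maps $\theta_s\colon\Omega\to\Omega$ such that $(\omega,s)\mapsto\theta_s\omega$ is measurable, $\theta_0$ is the identity, and $\theta_s\circ\theta_t=\theta_{s+t}$. $\mathbb{P}$ is a $\sigma$-finite (possibly infinite) measure on $(\Omega,\mathcal{A})$ which is stationary, i.e. $\mathbb{P}(\theta_sA)=\mathbb{P}(A)$ for all $s\in\mathbb{G}$, $A\in\mathcal{A}$. Let $\mathbf{M}$ be the space of measures on $\mathbb{G}$ that are finite on compact sets, with the smallest $\sigma$-field making all maps $\mu\mapsto\mu(B)$, $B\in\mathcal{G}$, measurable, and $\mathbf{N}\subset\mathbf{M}$ the subset of measures that are integer-valued on relatively compact Borel sets. A random measure (resp. point process) is a measurable map $\xi\colon\Omega\to\mathbf{M}$ (resp. $\Omega\to\mathbf{N}$); write $\xi(\omega,B):=\xi(\omega)(B)$. A point process $\eta$ is simple if $\eta(\omega,\{s\})\le1$ for all $(\omega,s)$. A random measure $\xi$ is invariant if $\xi(\omega,B+s)=\xi(\theta_s\omega,B)$ for all $\omega\in\Omega$, $s\in\mathbb{G}$, $B\in\mathcal{G}$. The Palm measure of an invariant random measure $\xi$ with respect to $\mathbb{P}$ is $$\mathbb{P}_\xi(A):=\lambda(B)^{-1}\iint\mathbf 1_A(\theta_s\omega)\mathbf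 1_B(s)\,\xi(\omega,ds)\,\mathbb{P}(d\omega),\quad A\in\mathcal{A},$$ where $B\in\mathcal{G}$ is any set with $0<\lambda(B)<\infty$ (the definition does not depend on $B$). An allocation is a measurable map $\tau\colon\Omega\times\mathbb{G}\to\mathbb{G}\cup\{\infty\}$ (with $\infty\notin\mathbb{G}$) such that $\tau(\theta_t\omega,s-t)=\tau(\omega,s)-t$ for all $s,t\in\mathbb{G}$, $\omega\in\Omega$, where $\infty-t:=\infty$. The integrand on the left-hand side is understood to be $0$ when $\tau(\omega,0)=\infty$. $\operatorname{supp}\mu$ denotes the support of the measure $\mu$. *)

theory Defs
  imports "HOL-Analysis.Analysis"
begin

definition haar_measure :: "'g::topological_ab_group_add measure \<Rightarrow> bool" where
  "haar_measure \<nu> \<longleftrightarrow>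
     sets \<nu> = sets borel \<and>
     (\<forall>K. compact K \<longrightarrow> emeasure \<nu> K < \<infinity>) \<and>
     (\<forall>B\<in>sets borel. \<forall>s. emeasure \<nu> ((\<lambda>x. x + s) ` B) = emeasure \<nu> B) \<and>
     emeasure \<nu> UNIV \<noteq> 0"

text \<open>The underlying measurable space of a flow is given by \<open>space M\<close> and \<open>sets M\<close>.\<close>

definition measurable_flow ::
  "'w measure \<Rightarrow> ('g::topological_ab_group_add \<Rightarrow> 'w \<Rightarrow> 'w) \<Rightarrow> bool" where
  "measurable_flow M \<theta> \<longleftrightarrow>
     (\<lambda>(\<omega>, s). \<theta> s \<omega>) \<in> M \<Otimes>\<^sub>M borel \<rightarrow>\<^sub>M M \<and>
     (\<forall>\<omega>\<in>space M. \<theta> 0 \<omega> = \<omega>) \<and>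
     (\<forall>\<omega>\<in>space M. \<forall>s t. \<theta> s (\<theta> t \<omega>) = \<theta> (s + t) \<omega>)"

definition stationary :: "'w measure \<Rightarrow> ('g \<Rightarrow> 'w \<Rightarrow> 'w) \<Rightarrow> bool" where
  "stationary P \<theta> \<longleftrightarrow> (\<forall>s. \<forall>A\<in>sets P. emeasure P (\<theta> s ` A) = emeasure P A)"


definition locally_finite_measures :: "'g::topological_space measure set" where
  "locally_finite_measures =
     {\<mu>. sets \<mu> = sets borel \<and> (\<forall>K. compact K \<longrightarrow> emeasure \<mu> K < \<infinity>)}"

definition locally_finite_algebra :: "'g::topological_space measure measure" where
  "locally_finite_algebra =
     (SUP B \<in> sets borel. vimage_algebra locally_finite_measures (\<lambda>\<mu>. emeasure \<mu> B) borel)"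

definition counting_measures :: "'g::topological_space measure set" where
  "counting_measures =
     {\<mu> \<in> locally_finite_measures.
        \<forall>B\<in>sets borel. compact (closure B) \<longrightarrow> emeasure \<mu> B \<in> \<nat>}"

definition random_measure :: "'w measure \<Rightarrow> ('w \<Rightarrow> 'g::topological_space measure) \<Rightarrow> bool" where
  "random_measure M \<xi> \<longleftrightarrow> \<xi> \<in> M \<rightarrow>\<^sub>M locally_finite_algebra"

definition point_process :: "'w measure \<Rightarrow> ('w \<Rightarrow> 'g::topological_space measure) \<Rightarrow> bool" where
  "point_process M \<eta> \<longleftrightarrow> \<eta> \<in> M \<rightarrow>\<^sub>M restrict_space locally_finite_algebra counting_measures"

definition simple_process :: "'w measure \<Rightarrow> ('w \<Rightarrow> 'g measure) \<Rightarrow> bool" where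
  "simple_process M \<eta> \<longleftrightarrow> (\<forall>\<omega>\<in>space M. \<forall>s. emeasure (\<eta> \<omega>) {s} \<le> 1)"

definition invariant_measure ::
  "'w measure \<Rightarrow> ('g::topological_ab_group_add \<Rightarrow> 'w \<Rightarrow> 'w) \<Rightarrow> ('w \<Rightarrow> 'g measure) \<Rightarrow> bool" where
  "invariant_measure M \<theta> \<xi> \<longleftrightarrow>
     (\<forall>\<omega>\<in>space M. \<forall>s. \<forall>B\<in>sets borel.
        emeasure (\<xi> \<omega>) ((\<lambda>x. x + s) ` B) = emeasure (\<xi> (\<theta> s \<omega>)) B)"

definition measure_support :: "'g::topological_space measure \<Rightarrow> 'g set" where
  "measure_support \<mu> = {x. \<forall>U. open U \<longrightarrow> x \<in> U \<longrightarrow> 0 < emeasure \<mu> U}"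


text \<open>The normalising set \<open>B\<close> is an explicit parameter; the value is meaningful, and independent
  of \<open>B\<close>, when \<open>B\<close> is a Borel set with \<open>0 < emeasure \<nu> B < \<infinity>\<close>.\<close>

definition palm_measure ::
  "'w measure \<Rightarrow> ('g \<Rightarrow> 'w \<Rightarrow> 'w) \<Rightarrow> 'g measure \<Rightarrow> 'g set \<Rightarrow> ('w \<Rightarrow> 'g measure) \<Rightarrow> 'w measure" where
  "palm_measure P \<theta> \<nu> B \<xi> =
     measure_of (space P) (sets P)
       (\<lambda>A. inverse (emeasure \<nu> B) *
            (\<integral>\<^sup>+\<omega>. (\<integral>\<^sup>+s. indicator A (\<theta> s \<omega>) * indicator B s \<partial>\<xi> \<omega>) \<partial>P))"


text \<open>The space \<open>\<G> \<union> {\<infinity>}\<close> is rendered by the option type, with \<open>None\<close> for \<open>\<infinity>\<close>; its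
  \<open>\<sigma>\<close>-field is generated by the Borel sets of the group and the singleton \<open>{\<infinity>}\<close>.\<close>

definition extended_borel :: "'g::topological_space option measure" where
  "extended_borel = sigma UNIV (insert {None} ((\<lambda>B. Some ` B) ` sets borel))"

definition allocation ::
  "'w measure \<Rightarrow> ('g::topological_ab_group_add \<Rightarrow> 'w \<Rightarrow> 'w) \<Rightarrow> ('w \<Rightarrow> 'g \<Rightarrow> 'g option) \<Rightarrow> bool" where
  "allocation M \<theta> \<tau> \<longleftrightarrow>
     (\<lambda>(\<omega>, s). \<tau> \<omega> s) \<in> M \<Otimes>\<^sub>M borel \<rightarrow>\<^sub>M extended_borel \<and>
     (\<forall>\<omega>\<in>space M. \<forall>s t. \<tau> (\<theta> t \<omega>) (s - t) = map_option (\<lambda>x. x - t) (\<tau> \<omega> s))"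

definition allocation_cell :: "('w \<Rightarrow> 'g \<Rightarrow> 'g option) \<Rightarrow> 'w \<Rightarrow> 'g \<Rightarrow> 'g set" where
  "allocation_cell \<tau> \<omega> s = {t. \<tau> \<omega> t = Some s}"

end

theory Submission
  imports Defs
begin

text \<open>
  Put \<open>F \<omega> s t = h (\<theta>\<^sub>s \<omega>, \<theta>\<^sub>t \<omega>)\<close> if \<open>\<tau> \<omega> s = t\<close>, and \<open>0\<close> otherwise; this is invariant under the
  diagonal shift \<open>(\<omega>, s, t) \<mapsto> (\<theta>\<^sub>u \<omega>, s - u, t - u)\<close>. Since \<open>\<eta> \<omega>\<close> has mass one at every point of its
  support, integrating \<open>F\<close> over \<open>t\<close> against \<open>\<eta> \<omega>\<close> evaluates \<open>h\<close> at \<open>t = \<tau> \<omega> s\<close>, so both sides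
  are normalised integrals of \<open>F\<close> over \<open>\<eta> \<omega> \<otimes> \<xi> \<omega> \<otimes> P\<close>, the left one with \<open>s\<close> restricted to \<open>B\<close>,
  the right one with \<open>t\<close> restricted to \<open>B'\<close>. They agree by the mass transport principle: integrate
  \<open>1\<^sub>B(s) 1\<^sub>B\<^sub>'(t + u)\<close> over Haar measure in \<open>u\<close>, apply the diagonal shift by \<open>u\<close>, and integrate
  \<open>1\<^sub>B(s - u) 1\<^sub>B\<^sub>'(t)\<close>.
\<close>

section \<open>Locally finite kernels\<close>

lemma compact_neighbourhood:
  assumes "locally_compact_space (euclidean :: 'g topology)"
  shows "\<exists>U K. open U \<and> compact K \<and> (x :: 'g::topological_space) \<in> U \<and> U \<subseteq> K"
  using assms unfolding locally_compact_space_def by (simp add: open_openin[symmetric])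

text \<open>By the Lindelof property countably many relatively compact open sets cover the group;
  disjointing them keeps them Borel and inside compact sets. The pieces have finite mass under every
  locally finite measure.\<close>

lemma sigma_compact_partition:
  assumes "locally_compact_space (euclidean :: 'g topology)"
  shows "\<exists>D :: nat \<Rightarrow> 'g::{second_countable_topology, t2_space} set.
    (\<forall>n. D n \<in> sets borel) \<and> disjoint_family D \<and> (\<Union>n. D n) = UNIV \<and>
    (\<forall>n. \<exists>K. compact K \<and> D n \<subseteq> K)"
proof -
  let ?\<U> = "{U :: 'g set. open U \<and> (\<exists>K. compact K \<and> U \<subseteq> K)}"
  have "\<Union>?\<U> = UNIV"
    using compact_neighbourhood[OF assms] by blast
  moreover obtain \<V> where \<V>: "\<V> \<subseteq> ?\<U>" "countable \<V>" "\<Union>\<V> = \<Union>?\<U>"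
    by (rule Lindelof[of ?\<U>]) auto
  ultimately have cover: "\<Union>\<V> = UNIV" by simp
  then have "\<V> \<noteq> {}" by (metis Union_empty UNIV_not_empty)
  define A where "A = from_nat_into \<V>"
  have A: "range A = \<V>"
    unfolding A_def using \<open>\<V> \<noteq> {}\<close> \<V>(2) by (rule range_from_nat_into)
  show ?thesis
  proof (intro exI[of _ "disjointed A"] conjI allI)
    show "disjointed A n \<in> sets borel" for n
    proof -
      have "range A \<subseteq> sets borel" unfolding A using \<V>(1) by auto
      then show ?thesis by (rule sets.range_disjointed_sets[THEN subsetD, OF _ rangeI])
    qed
    show "disjoint_family (disjointed A)" by (rule disjoint_family_disjointed)
    show "(\<Union>n. disjointed A n) = UNIV"
      using A cover by (simp add: UN_disjointed_eq)
    show "\<exists>K. compact K \<and> disjointed A n \<subseteq> K" for n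
    proof -
      have "A n \<in> ?\<U>" using A \<V>(1) by blast
      then show ?thesis using disjointed_subset[of A n] by blast
    qed
  qed
qed

text \<open>Each piece of the partition lies in a compact set and so has finite mass. This applies
  to Haar measure and to every realisation of a random measure, and thereby justifies the later uses
  of Tonelli's theorem.\<close>

lemma sigma_finite_locally_finite:
  fixes \<mu> :: "'g::{second_countable_topology, t2_space} measure"
  assumes lc: "locally_compact_space (euclidean :: 'g topology)"
    and sets: "sets \<mu> = sets borel" and fin: "\<And>K. compact K \<Longrightarrow> emeasure \<mu> K < \<infinity>"
  shows "sigma_finite_measure \<mu>"
proof -
  obtain D :: "nat \<Rightarrow> 'g set" where D: "\<And>n. D n \<in> sets borel" "disjoint_family D"
    "(\<Union>n. D n) = UNIV"
    "\<And>n. \<exists>K. compact K \<and> D n \<subseteq> K"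
    using sigma_compact_partition[OF lc] by blast
  show ?thesis
  proof
    have "emeasure \<mu> (D n) \<noteq> \<infinity>" for n
    proof -
      obtain K where K: "compact K" "D n \<subseteq> K" using D(4) by blast
      then have "emeasure \<mu> (D n) \<le> emeasure \<mu> K"
        by (intro emeasure_mono) (auto simp: sets borel_compact)
      then show ?thesis using fin[OF K(1)] by auto
    qed
    then show "\<exists>A. countable A \<and> A \<subseteq> sets \<mu> \<and> \<Union> A = space \<mu> \<and> (\<forall>a\<in>A. emeasure \<mu> a \<noteq> \<infinity>)"
      using D sets_eq_imp_space_eq[OF sets]
      by (intro exI[of _ "range D"]) (auto simp: sets)
  qed
qed

section \<open>Random measures as measurable kernels\<close>

lemma space_locally_finite_algebra: "space locally_finite_algebra = locally_finite_measures"
  by (auto simp: locally_finite_algebra_def space_Sup_eq_UN)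

lemma measurable_emeasure_locally_finite_algebra:
  "B \<in> sets borel \<Longrightarrow> (\<lambda>\<mu>. emeasure \<mu> B) \<in> borel_measurable locally_finite_algebra"
  by (auto intro!: measurable_Sup1 measurable_vimage_algebra1 simp: locally_finite_algebra_def)

lemma random_measure_emeasure:
  "random_measure N \<kappa> \<Longrightarrow> B \<in> sets borel \<Longrightarrow> (\<lambda>x. emeasure (\<kappa> x) B) \<in> borel_measurable N"
  unfolding random_measure_def by (rule measurable_compose[OF _ measurable_emeasure_locally_finite_algebra])

lemma
  assumes "random_measure N \<kappa>" and "x \<in> space N"
  shows random_measure_sets: "sets (\<kappa> x) = sets borel"
    and random_measure_compact: "compact K \<Longrightarrow> emeasure (\<kappa> x) K < \<infinity>"
proof -
  have *: "\<kappa> x \<in> locally_finite_measures"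
    using measurable_space[OF assms[unfolded random_measure_def]] by (simp only: space_locally_finite_algebra)
  then show "sets (\<kappa> x) = sets borel" "compact K \<Longrightarrow> emeasure (\<kappa> x) K < \<infinity>"
    by (auto simp: locally_finite_measures_def)
qed

lemma random_measure_sigma_finite:
  fixes \<kappa> :: "'n \<Rightarrow> 'g::{second_countable_topology, t2_space} measure"
  assumes "locally_compact_space (euclidean :: 'g topology)" "random_measure N \<kappa>" "x \<in> space N"
  shows "sigma_finite_measure (\<kappa> x)"
  by (rule sigma_finite_locally_finite[OF assms(1) random_measure_sets[OF assms(2,3)] random_measure_compact[OF assms(2,3)]])

text \<open>Allows a random measure to be regarded as indexed by a larger parameter space, with
  \<open>g\<close> typically the projection to the sample point.\<close>

lemma random_measure_compose:
  "random_measure N \<kappa> \<Longrightarrow> g \<in> N' \<rightarrow>\<^sub>M N \<Longrightarrow> random_measure N' (\<lambda>x. \<kappa> (g x))"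
  unfolding random_measure_def by (rule measurable_compose)

lemma point_process_imp_random_measure:
  "point_process N \<eta> \<Longrightarrow> random_measure N \<eta>"
  unfolding point_process_def random_measure_def
  by (subst (asm) measurable_restrict_space2_iff) auto

text \<open>A Dynkin class argument in \<open>S\<close>, starting from rectangles. Intersecting with
  \<open>D\<close>, which sits inside the compact set \<open>K\<close>, keeps all masses finite, so
  that the complement step may subtract.\<close>

lemma random_measure_section_emeasure:
  fixes \<kappa> :: "'n \<Rightarrow> 'g::{second_countable_topology, t2_space} measure"
  assumes \<kappa>: "random_measure N \<kappa>" and D: "D \<in> sets borel" "compact K" "D \<subseteq> K"
    and "S \<in> sets (N \<Otimes>\<^sub>M borel)"
  shows "(\<lambda>x. emeasure (\<kappa> x) (Pair x -` S \<inter> D)) \<in> borel_measurable N"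
proof -
  have sec: "Pair x -` S \<inter> D \<in> sets (\<kappa> x)" if "x \<in> space N" "S \<in> sets (N \<Otimes>\<^sub>M borel)" for x S
    using sets_Pair1[OF that(2), of x] D(1) that by (auto simp: random_measure_sets[OF \<kappa>])
  have fin: "emeasure (\<kappa> x) (A \<inter> D) \<noteq> \<infinity>" if "x \<in> space N" "A \<inter> D \<in> sets (\<kappa> x)" for x A
  proof -
    have "emeasure (\<kappa> x) (A \<inter> D) \<le> emeasure (\<kappa> x) K"
      using D that by (intro emeasure_mono) (auto simp: random_measure_sets[OF \<kappa>] borel_compact)
    then show ?thesis using random_measure_compact[OF \<kappa> that(1) D(2)] by auto
  qed
  \<comment> \<open>The section of a rectangle is \<open>C\<close> or empty, so its mass is an
    indicator times a mass that is measurable by the choice of the sigma-field on measures.\<close>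
  have rect: "(\<lambda>x. emeasure (\<kappa> x) (Pair x -` (A \<times> C) \<inter> D)) \<in> borel_measurable N"
    if "A \<in> sets N" "C \<in> sets borel" for A C
  proof -
    have "(\<lambda>x. indicator A x * emeasure (\<kappa> x) (C \<inter> D)) \<in> borel_measurable N"
      using that D(1) by (intro borel_measurable_times_ennreal random_measure_emeasure[OF \<kappa>]) auto
    also have "(\<lambda>x. indicator A x * emeasure (\<kappa> x) (C \<inter> D))
        = (\<lambda>x. emeasure (\<kappa> x) (Pair x -` (A \<times> C) \<inter> D))"
      by (auto simp: fun_eq_iff indicator_def)
    finally show ?thesis .
  qed
  have "S \<in> sigma_sets (space N \<times> UNIV) {a \<times> b |a b. a \<in> sets N \<and> b \<in> sets (borel :: 'g measure)}"
    using assms(5) by (simp add: sets_pair_measure)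
  with Int_stable_pair_measure_generator pair_measure_closed[of N borel, unfolded space_borel]
  show ?thesis
  proof (induct S rule: sigma_sets_induct_disjoint)
    case (basic A)
    then show ?case using rect by auto
  next
    case empty
    then show ?case by simp
  next
    case (compl S)
    then have S: "S \<in> sets (N \<Otimes>\<^sub>M borel)" by (simp add: sets_pair_measure)
    have "(\<lambda>x. emeasure (\<kappa> x) (Pair x -` (space N \<times> UNIV) \<inter> D) - emeasure (\<kappa> x) (Pair x -` S \<inter> D)) \<in> borel_measurable N"
      using rect[OF sets.top, of UNIV] compl(2) by (intro borel_measurable_minus_ennreal) auto
    also have "?this \<longleftrightarrow> ?case"
    proof (rule measurable_cong)
      fix x assume x: "x \<in> space N"
      have "Pair x -` (space N \<times> UNIV - S) \<inter> D = Pair x -` (space N \<times> UNIV) \<inter> D - Pair x -` S \<inter> D"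
        by auto
      moreover have "Pair x -` S \<inter> D \<subseteq> Pair x -` (space N \<times> UNIV) \<inter> D"
        using x by auto
      ultimately show "emeasure (\<kappa> x) (Pair x -` (space N \<times> UNIV) \<inter> D) - emeasure (\<kappa> x) (Pair x -` S \<inter> D)
          = emeasure (\<kappa> x) (Pair x -` (space N \<times> UNIV - S) \<inter> D)"
        using x D(1) sec[OF x S] fin[OF x sec[OF x S]]
        by (simp add: emeasure_Diff random_measure_sets[OF \<kappa>])
    qed
    finally show ?case .
  next
    case (union S)
    then have S: "S i \<in> sets (N \<Otimes>\<^sub>M borel)" for i by (auto simp: sets_pair_measure)
    have "(\<lambda>x. \<Sum>i. emeasure (\<kappa> x) (Pair x -` S i \<inter> D)) \<in> borel_measurable N"
      using union by (intro borel_measurable_suminf_order) auto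
    also have "?this \<longleftrightarrow> ?case"
    proof (rule measurable_cong)
      fix x assume x: "x \<in> space N"
      have "(\<Sum>i. emeasure (\<kappa> x) (Pair x -` S i \<inter> D)) = emeasure (\<kappa> x) (\<Union>i. Pair x -` S i \<inter> D)"
        using sec[OF x S] union(1)
        by (intro suminf_emeasure) (auto simp: disjoint_family_on_def)
      also have "(\<Union>i. Pair x -` S i \<inter> D) = Pair x -` (\<Union>i. S i) \<inter> D" by auto
      finally show "(\<Sum>i. emeasure (\<kappa> x) (Pair x -` S i \<inter> D)) = emeasure (\<kappa> x) (Pair x -` (\<Union>i. S i) \<inter> D)" .
    qed
    finally show ?case .
  qed
qed

lemma random_measure_section_measurable:
  assumes "random_measure N \<kappa>" "x \<in> space N" "f \<in> N \<Otimes>\<^sub>M borel \<rightarrow>\<^sub>M L"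
  shows "(\<lambda>s. f (x, s)) \<in> \<kappa> x \<rightarrow>\<^sub>M L"
  using measurable_compose[OF measurable_Pair1'[OF assms(2)] assms(3)]
  by (subst measurable_cong_sets[OF random_measure_sets[OF assms(1,2)] refl])

text \<open>Monotone class induction on \<open>f\<close>. Only the indicator case has content: the
  mass of a section is the sum of its masses on the relatively compact pieces of the partition, each
  of which is measurable in \<open>x\<close>.\<close>

lemma random_measure_nn_integral:
  fixes \<kappa> :: "'n \<Rightarrow> 'g::{second_countable_topology, t2_space} measure"
  assumes lc: "locally_compact_space (euclidean :: 'g topology)"
    and \<kappa>: "random_measure N \<kappa>" and f: "f \<in> borel_measurable (N \<Otimes>\<^sub>M borel)"
  shows "(\<lambda>x. \<integral>\<^sup>+s. f (x, s) \<partial>\<kappa> x) \<in> borel_measurable N"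
  using f
proof (induct f rule: borel_measurable_induct)
  case (cong f g)
  have "(\<lambda>x. \<integral>\<^sup>+s. f (x, s) \<partial>\<kappa> x) \<in> borel_measurable N \<longleftrightarrow> (\<lambda>x. \<integral>\<^sup>+s. g (x, s) \<partial>\<kappa> x) \<in> borel_measurable N"
    using cong by (intro measurable_cong nn_integral_cong) (auto simp: space_pair_measure)
  then show ?case using cong by simp
next
  case (set S)
  obtain D :: "nat \<Rightarrow> 'g set" where D: "\<And>n. D n \<in> sets borel" "disjoint_family D" "(\<Union>n. D n) = UNIV"
    "\<And>n. \<exists>K. compact K \<and> D n \<subseteq> K"
    using sigma_compact_partition[OF lc] by blast
  have sec: "Pair x -` S \<in> sets borel" for x
    using sets_Pair1[OF set] by simp
  have "(\<lambda>x. \<Sum>n. emeasure (\<kappa> x) (Pair x -` S \<inter> D n)) \<in> borel_measurable N"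
  proof (rule borel_measurable_suminf_order)
    fix n
    obtain K where "compact K" "D n \<subseteq> K" using D(4) by blast
    then show "(\<lambda>x. emeasure (\<kappa> x) (Pair x -` S \<inter> D n)) \<in> borel_measurable N"
      by (rule random_measure_section_emeasure[OF \<kappa> D(1) _ _ set])
  qed
  also have "?this \<longleftrightarrow> (\<lambda>x. \<integral>\<^sup>+s. indicator S (x, s) \<partial>\<kappa> x) \<in> borel_measurable N"
  proof (rule measurable_cong)
    fix x assume x: "x \<in> space N"
    have "(\<Sum>n. emeasure (\<kappa> x) (Pair x -` S \<inter> D n)) = emeasure (\<kappa> x) (\<Union>n. Pair x -` S \<inter> D n)"
      using D(1,2) sec
      by (intro suminf_emeasure) (auto simp: random_measure_sets[OF \<kappa> x] disjoint_family_on_def)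
    also have "(\<Union>n. Pair x -` S \<inter> D n) = Pair x -` S" using D(3) by auto
    also have "emeasure (\<kappa> x) (Pair x -` S) = (\<integral>\<^sup>+s. indicator (Pair x -` S) s \<partial>\<kappa> x)"
      using sec by (simp add: random_measure_sets[OF \<kappa> x])
    finally show "(\<Sum>n. emeasure (\<kappa> x) (Pair x -` S \<inter> D n)) = (\<integral>\<^sup>+s. indicator S (x, s) \<partial>\<kappa> x)"
      by (simp add: indicator_vimage[unfolded comp_def, symmetric] indicator_def)
  qed
  finally show ?case .
next
  case (mult f c)
  have "(\<lambda>x. c * (\<integral>\<^sup>+s. f (x, s) \<partial>\<kappa> x)) \<in> borel_measurable N" using mult by simp
  also have "?this \<longleftrightarrow> ?case"
    by (intro measurable_cong nn_integral_cmult[symmetric] random_measure_section_measurable[OF \<kappa> _ mult(2)])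
  finally show ?case .
next
  case (add f g)
  have "(\<lambda>x. (\<integral>\<^sup>+s. f (x, s) \<partial>\<kappa> x) + (\<integral>\<^sup>+s. g (x, s) \<partial>\<kappa> x)) \<in> borel_measurable N" using add by simp
  also have "?this \<longleftrightarrow> ?case"
    by (subst add.commute, intro measurable_cong nn_integral_add[symmetric]
        random_measure_section_measurable[OF \<kappa> _ add(1)] random_measure_section_measurable[OF \<kappa> _ add(4)])
  finally show ?case .
next
  case (seq U)
  have "(\<lambda>x. SUP i. \<integral>\<^sup>+s. U i (x, s) \<partial>\<kappa> x) \<in> borel_measurable N"
    using seq by (intro borel_measurable_SUP) auto
  also have "?this \<longleftrightarrow> (\<lambda>x. \<integral>\<^sup>+s. (SUP i. U i (x, s)) \<partial>\<kappa> x) \<in> borel_measurable N"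
    using seq by (intro measurable_cong nn_integral_monotone_convergence_SUP[symmetric]
        random_measure_section_measurable[OF \<kappa>]) (simp_all add: incseq_def le_fun_def)
  finally show ?case by (simp add: SUP_apply image_comp)
qed

text \<open>The form suited to nested integrals: the integrating measure sees the parameter only
  through \<open>g\<close>, while the integrand may depend on all of it.\<close>

lemma random_measure_nn_integral_compose:
  fixes \<kappa> :: "'n \<Rightarrow> 'g::{second_countable_topology, t2_space} measure"
  assumes "locally_compact_space (euclidean :: 'g topology)" and \<kappa>: "random_measure N \<kappa>"
    and g: "g \<in> L \<rightarrow>\<^sub>M N" and f: "(\<lambda>(x, s). f x s) \<in> borel_measurable (L \<Otimes>\<^sub>M borel)"
  shows "(\<lambda>x. \<integral>\<^sup>+s. f x s \<partial>\<kappa> (g x)) \<in> borel_measurable L"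
  using random_measure_nn_integral[OF assms(1) random_measure_compose[OF \<kappa> g] f] by simp

text \<open>The masses of a decreasing neighbourhood base converge to the mass of the point; being integers,
  they vanish eventually if the limit is zero.\<close>

lemma measure_support_atom:
  fixes \<mu> :: "'g::{second_countable_topology, t2_space} measure"
  assumes lc: "locally_compact_space (euclidean :: 'g topology)"
    and \<mu>: "\<mu> \<in> counting_measures" and "emeasure \<mu> {x} \<le> 1" and x: "x \<in> measure_support \<mu>"
  shows "emeasure \<mu> {x} = 1"
proof -
  have sets: "sets \<mu> = sets borel"
    and fin: "\<And>K. compact K \<Longrightarrow> emeasure \<mu> K < \<infinity>"
    and nat: "\<And>C. C \<in> sets borel \<Longrightarrow> compact (closure C) \<Longrightarrow> emeasure \<mu> C \<in> \<nat>"
    using \<mu> by (auto simp: counting_measures_def locally_finite_measures_def)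
  have small: "y = 0" if y: "y \<in> \<nat>" "y < 1" for y :: ennreal
  proof -
    obtain n where n: "y = of_nat n" using y(1) by (auto simp: Nats_def)
    with y(2) have "n < 1" by (metis of_nat_1 of_nat_less_iff)
    then show ?thesis using n by simp
  qed
  have "emeasure \<mu> {x} \<noteq> 0"
  proof
    assume 0: "emeasure \<mu> {x} = 0"
    obtain U K where UK: "open U" "compact K" "x \<in> U" "U \<subseteq> K"
      using compact_neighbourhood[OF lc] by blast
    obtain A :: "nat \<Rightarrow> 'g set" where A: "\<And>i. open (A i)" "\<And>i. x \<in> A i"
      "\<And>S. open S \<Longrightarrow> x \<in> S \<Longrightarrow> eventually (\<lambda>i. A i \<subseteq> S) sequentially"
      using countable_basis_at_decseq[of x] by blast
    \<comment> \<open>Intersecting with \<open>U\<close> keeps the sets inside \<open>K\<close>: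
      this gives finite masses for continuity from above, and compact closures for
      integrality.\<close>
    define V where "V n = U \<inter> (\<Inter>i\<le>n. A i)" for n
    have V: "open (V n)" "x \<in> V n" "V n \<subseteq> K" for n
      using UK A by (auto simp: V_def)
    \<comment> \<open>By the Hausdorff property the complement of any other point \<open>y\<close>
      is an open neighbourhood of \<open>x\<close>, hence contains some \<open>A n\<close>.\<close>
    have "(\<Inter>n. V n) = {x}"
    proof (intro equalityI subsetI)
      fix y assume y: "y \<in> (\<Inter>n. V n)"
      show "y \<in> {x}"
      proof (rule ccontr)
        assume "y \<notin> {x}"
        then have "eventually (\<lambda>i. A i \<subseteq> - {y}) sequentially"
          by (intro A(3)) (auto simp: open_Compl)
        then obtain n where "A n \<subseteq> - {y}" by (auto simp: eventually_sequentially)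
        moreover have "y \<in> A n" using y by (auto simp: V_def)
        ultimately show False by auto
      qed
    qed (use V in auto)
    moreover have finV: "emeasure \<mu> (V n) \<noteq> \<infinity>" for n
    proof -
      have "emeasure \<mu> (V n) \<le> emeasure \<mu> K"
        using V(3) UK(2) by (intro emeasure_mono) (auto simp: sets borel_compact)
      then show ?thesis using fin[OF UK(2)] by auto
    qed
    moreover have "decseq V" by (auto simp: decseq_def V_def)
    moreover have "range V \<subseteq> sets \<mu>" using V(1) by (auto simp: sets)
    ultimately have "(\<lambda>n. emeasure \<mu> (V n)) \<longlonglongrightarrow> emeasure \<mu> {x}"
      using Lim_emeasure_decseq[of V \<mu>] by simp
    then have "eventually (\<lambda>n. emeasure \<mu> (V n) < 1) sequentially"
      using 0 by (intro order_tendstoD(2)) auto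
    then obtain n where n: "emeasure \<mu> (V n) < 1" by (auto simp: eventually_sequentially)
    have "closure (V n) \<subseteq> K"
      using V(3) UK(2) by (intro closure_minimal compact_imp_closed)
    then have "compact (closure (V n))"
      using UK(2) by (metis closed_closure compact_Int_closed inf.absorb_iff2)
    then have "emeasure \<mu> (V n) = 0"
      using n V(1) by (intro small nat) auto
    moreover have "0 < emeasure \<mu> (V n)"
      using x V(1,2) by (simp add: measure_support_def)
    ultimately show False by simp
  qed
  moreover have "emeasure \<mu> {x} \<in> \<nat>" by (intro nat) auto
  \<comment> \<open>The mass of the point is a nonzero integer and at most one; \<open>small\<close>
    rules out any value below one.\<close>
  ultimately show ?thesis using small[of "emeasure \<mu> {x}"] assms(3) by force
qed

section \<open>Measurability on the group with infinity adjoined\<close>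

text \<open>The value \<open>the None\<close> is some fixed but unspecified group element, so the
  preimage of \<open>C\<close> is \<open>Some\<close> applied to \<open>C\<close>, possibly enlarged
  by the point at infinity; both parts are generators. Together with the test for
  \<open>None\<close> this reduces an allocation to an event and a group-valued map.\<close>

lemma measurable_extended_borel_the:
  "the \<in> borel_measurable (extended_borel :: 'g::topological_space option measure)"
proof (rule measurableI)
  have sp: "space (extended_borel :: 'g option measure) = UNIV"
    by (simp add: extended_borel_def space_measure_of_conv)
  fix C :: "'g set" assume C: "C \<in> sets borel"
  have "the -` C = Some ` C \<union> (if the None \<in> C then {None} else {})"
  proof (intro set_eqI)
    fix z :: "'g option"
    show "z \<in> the -` C \<longleftrightarrow> z \<in> Some ` C \<union> (if the None \<in> C then {None} else {})"
      by (cases z) auto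
  qed
  moreover have "Some ` C \<in> sets extended_borel" "{None} \<in> sets (extended_borel :: 'g option measure)"
    using C by (auto simp: extended_borel_def)
  ultimately show "the -` C \<inter> space extended_borel \<in> sets extended_borel"
    by (auto simp: sp simp del: Un_insert_right)
qed auto

lemma pred_extended_borel_None:
  "Measurable.pred (extended_borel :: 'g::topological_space option measure) (\<lambda>z. z = None)"
  by (simp add: pred_def extended_borel_def space_measure_of_conv)

section \<open>Haar measure\<close>

text \<open>Subtraction is continuous, and second countability identifies the Borel field of the
  product with the product of the Borel fields.\<close>

lemma borel_measurable_group_diff[measurable (raw)]:
  fixes f g :: "'n \<Rightarrow> 'g::{topological_ab_group_add, second_countable_topology}"
  assumes "f \<in> borel_measurable N" "g \<in> borel_measurable N"
  shows "(\<lambda>x. f x - g x) \<in> borel_measurable N"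
  using assms by (rule borel_measurable_continuous_Pair) (intro continuous_intros)

lemma borel_measurable_group_uminus[measurable (raw)]:
  fixes f :: "'n \<Rightarrow> 'g::{topological_ab_group_add, second_countable_topology}"
  assumes "f \<in> borel_measurable N"
  shows "(\<lambda>x. - f x) \<in> borel_measurable N"
  using borel_measurable_group_diff[of "\<lambda>_. 0" N f] assms by simp

text \<open>The hypothesis says that \<mu>' is the image of \<mu> under subtraction of
  \<open>s\<close>, because the preimage of \<open>C\<close> under that map is \<open>C\<close>
  shifted by \<open>s\<close>. Two measures are allowed so as to cover Haar measure, where they
  coincide, and invariant random measures, where they belong to \<omega> and to its shift.\<close>

lemma nn_integral_translate:
  fixes \<mu> \<mu>' :: "'g::{topological_ab_group_add, second_countable_topology} measure"
  assumes sets: "sets \<mu> = sets borel" "sets \<mu>' = sets borel"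
    and eq: "\<And>C. C \<in> sets borel \<Longrightarrow> emeasure \<mu> ((\<lambda>x. x + s) ` C) = emeasure \<mu>' C"
    and f: "f \<in> borel_measurable borel"
  shows "(\<integral>\<^sup>+x. f x \<partial>\<mu>') = (\<integral>\<^sup>+x. f (x - s) \<partial>\<mu>)"
proof -
  have minus: "(\<lambda>x. x - s) \<in> borel_measurable \<mu>"
    by (subst measurable_cong_sets[OF sets(1) refl]) measurable
  have "\<mu>' = distr \<mu> borel (\<lambda>x. x - s)"
  proof (rule measure_eqI)
    fix C assume "C \<in> sets \<mu>'"
    then have C: "C \<in> sets borel" by (simp add: sets)
    have "emeasure \<mu>' C = emeasure \<mu> ((\<lambda>x. x + s) ` C)" using eq[OF C] by simp
    also have "(\<lambda>x. x + s) ` C = (\<lambda>x. x - s) -` C \<inter> space \<mu>"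
      using sets_eq_imp_space_eq[OF sets(1)] by (force simp: image_iff)
    also have "emeasure \<mu> \<dots> = emeasure (distr \<mu> borel (\<lambda>x. x - s)) C"
      using emeasure_distr[OF minus C] by simp
    finally show "emeasure \<mu>' C = emeasure (distr \<mu> borel (\<lambda>x. x - s)) C" .
  qed (simp add: sets)
  then show ?thesis using f by (simp add: nn_integral_distr[OF minus])
qed

lemma nn_integral_haar_translate:
  fixes \<nu> :: "'g::{topological_ab_group_add, second_countable_topology} measure"
  assumes \<nu>: "haar_measure \<nu>" and f: "f \<in> borel_measurable borel"
  shows "(\<integral>\<^sup>+u. f (u - s) \<partial>\<nu>) = (\<integral>\<^sup>+u. f u \<partial>\<nu>)"
  using \<nu> by (intro nn_integral_translate[symmetric] f) (auto simp: haar_measure_def)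

text \<open>Invariance under inversion comes from integrating \<open>1\<^sub>B(s) 1\<^sub>B\<^sub>'(u + s)\<close> over \<open>\<nu> \<otimes> \<nu>\<close> in both orders; the
  auxiliary set \<open>B'\<close> only serves to cancel its measure.\<close>

lemma nn_integral_haar_reflect:
  fixes \<nu> :: "'g::{topological_ab_group_add, second_countable_topology, t2_space} measure"
  assumes lc: "locally_compact_space (euclidean :: 'g topology)" and \<nu>: "haar_measure \<nu>"
    and B[measurable]: "B \<in> sets borel" and B'[measurable]: "B' \<in> sets borel"
    and pos: "0 < emeasure \<nu> B'" "emeasure \<nu> B' < \<infinity>"
  shows "(\<integral>\<^sup>+u. indicator B (s - u) \<partial>\<nu>) = emeasure \<nu> B"
proof -
  have sets_nu[measurable_cong]: "sets \<nu> = sets borel" using \<nu> by (simp add: haar_measure_def)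
  interpret \<nu>: sigma_finite_measure \<nu>
    using \<nu> by (intro sigma_finite_locally_finite[OF lc]) (auto simp: haar_measure_def)
  interpret pair_sigma_finite \<nu> \<nu> ..
  let ?m = "\<integral>\<^sup>+u. indicator B (- u) \<partial>\<nu>"
  \<comment> \<open>Translation invariance removes \<open>s\<close>, which leaves the mass of the
    reflected set.\<close>
  have refl: "(\<integral>\<^sup>+u. indicator B (s - u) \<partial>\<nu>) = ?m" for s
    using nn_integral_haar_translate[OF \<nu>, of "\<lambda>u. indicator B (- u)" s] by simp
  have "emeasure \<nu> B * emeasure \<nu> B' = (\<integral>\<^sup>+s. indicator B s * emeasure \<nu> B' \<partial>\<nu>)"
    by (simp add: nn_integral_multc sets_nu)
  also have "\<dots> = (\<integral>\<^sup>+s. \<integral>\<^sup>+u. indicator B s * indicator B' (u + s) \<partial>\<nu> \<partial>\<nu>)"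
  proof (rule nn_integral_cong)
    fix s
    show "indicator B s * emeasure \<nu> B' = (\<integral>\<^sup>+u. indicator B s * indicator B' (u + s) \<partial>\<nu>)"
      using nn_integral_haar_translate[OF \<nu>, of "indicator B'" "- s"]
      by (simp add: nn_integral_cmult sets_nu)
  qed
  also have "\<dots> = (\<integral>\<^sup>+u. \<integral>\<^sup>+s. indicator B s * indicator B' (u + s) \<partial>\<nu> \<partial>\<nu>)"
    by (rule Fubini'[symmetric]) measurable
  \<comment> \<open>For fixed \<open>u\<close> the variable \<open>s\<close> is translated by
    \<open>u\<close>, which moves the shift from \<open>B'\<close> to \<open>B\<close>. After the
    next exchange the inner integral over \<open>u\<close> is the reflected one.\<close>
  also have "\<dots> = (\<integral>\<^sup>+u. \<integral>\<^sup>+s. indicator B (s - u) * indicator B' s \<partial>\<nu> \<partial>\<nu>)"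
  proof (rule nn_integral_cong)
    fix u
    show "(\<integral>\<^sup>+s. indicator B s * indicator B' (u + s) \<partial>\<nu>) = (\<integral>\<^sup>+s. indicator B (s - u) * indicator B' s \<partial>\<nu>)"
      using nn_integral_haar_translate[OF \<nu>, of "\<lambda>s. indicator B s * indicator B' (u + s)" u] by simp
  qed
  also have "\<dots> = (\<integral>\<^sup>+s. \<integral>\<^sup>+u. indicator B (s - u) * indicator B' s \<partial>\<nu> \<partial>\<nu>)"
    by (rule Fubini') measurable
  also have "\<dots> = ?m * emeasure \<nu> B'"
    by (simp add: nn_integral_multc refl nn_integral_cmult sets_nu)
  finally have "emeasure \<nu> B = ?m"
    using pos by (auto simp: mult.commute[of _ "emeasure \<nu> B'"] ennreal_mult_cancel_left)
  then show ?thesis by (simp add: refl)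
qed

text \<open>Turns the division-free form of mass transport into an equality of Palm normalisations.
  Positivity and finiteness make \<open>inverse\<close> a true inverse in the extended nonnegative
  reals.\<close>

lemma ennreal_divide_cross:
  fixes a b x y :: ennreal
  assumes "b * x = a * y" "0 < a" "a < \<infinity>" "0 < b" "b < \<infinity>"
  shows "inverse a * x = inverse b * y"
proof -
  have a: "inverse a * a = 1" and b: "inverse b * b = 1"
    using assms(2-5) ennreal_divide_self[of a] ennreal_divide_self[of b]
    by (auto simp: divide_ennreal_def mult.commute)
  have "inverse a * x = inverse a * (inverse b * (b * x))"
    by (simp add: mult.assoc[symmetric] b)
  also have "\<dots> = inverse b * ((inverse a * a) * y)"
    by (simp add: assms(1) ac_simps)
  finally show ?thesis by (simp add: a)
qed

text \<open>Restates joint measurability as a composition rule with one premise per argument, the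
  shape that automatic measurability proofs can apply; the next two lemmas do so for more
  arguments.\<close>

lemma measurable_curry2:
  assumes "(\<lambda>(x, y). f x y) \<in> A \<Otimes>\<^sub>M B \<rightarrow>\<^sub>M L" "a \<in> N \<rightarrow>\<^sub>M A" "b \<in> N \<rightarrow>\<^sub>M B"
  shows "(\<lambda>x. f (a x) (b x)) \<in> N \<rightarrow>\<^sub>M L"
  using measurable_compose[OF measurable_Pair[OF assms(2,3)] assms(1)] by simp

lemma measurable_curry3:
  assumes "(\<lambda>(x, y, z). f x y z) \<in> A \<Otimes>\<^sub>M B \<Otimes>\<^sub>M C \<rightarrow>\<^sub>M L"
    and "a \<in> N \<rightarrow>\<^sub>M A" "b \<in> N \<rightarrow>\<^sub>M B" "c \<in> N \<rightarrow>\<^sub>M C"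
  shows "(\<lambda>x. f (a x) (b x) (c x)) \<in> N \<rightarrow>\<^sub>M L"
  using measurable_compose[OF measurable_Pair[OF assms(2) measurable_Pair[OF assms(3,4)]] assms(1)] by simp

lemma measurable_curry4:
  assumes "(\<lambda>(x, y, z, w). f x y z w) \<in> A \<Otimes>\<^sub>M B \<Otimes>\<^sub>M C \<Otimes>\<^sub>M D \<rightarrow>\<^sub>M L"
    and "a \<in> N \<rightarrow>\<^sub>M A" "b \<in> N \<rightarrow>\<^sub>M B" "c \<in> N \<rightarrow>\<^sub>M C" "d \<in> N \<rightarrow>\<^sub>M D"
  shows "(\<lambda>x. f (a x) (b x) (c x) (d x)) \<in> N \<rightarrow>\<^sub>M L"
  using measurable_compose[OF measurable_Pair[OF assms(2) measurable_Pair[OF assms(3)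
    measurable_Pair[OF assms(4,5)]]] assms(1)] by simp

section \<open>Palm measures and mass transport\<close>

locale stationary_flow = sigma_finite_measure P
  for P :: "'w measure" +
  fixes \<theta> :: "'g::{topological_ab_group_add, second_countable_topology, t2_space} \<Rightarrow> 'w \<Rightarrow> 'w"
  assumes locally_compact: "locally_compact_space (euclidean :: 'g topology)"
    and flow: "measurable_flow P \<theta>"
    and stationary: "stationary P \<theta>"
begin

lemma measurable_flow_compose[measurable (raw)]:
  assumes "g \<in> borel_measurable N" "f \<in> N \<rightarrow>\<^sub>M P"
  shows "(\<lambda>x. \<theta> (g x) (f x)) \<in> N \<rightarrow>\<^sub>M P"
proof -
  have "(\<lambda>(\<omega>, s). \<theta> s \<omega>) \<in> P \<Otimes>\<^sub>M borel \<rightarrow>\<^sub>M P"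
    using flow by (simp add: measurable_flow_def)
  from measurable_compose[OF measurable_Pair[OF assms(2,1)] this] show ?thesis by simp
qed

lemma flow_in_space[simp]: "\<omega> \<in> space P \<Longrightarrow> \<theta> s \<omega> \<in> space P"
  using measurable_space[OF measurable_flow_compose[of "\<lambda>_. s" P "\<lambda>x. x"]] by simp

lemma flow_zero[simp]: "\<omega> \<in> space P \<Longrightarrow> \<theta> 0 \<omega> = \<omega>"
  and flow_add[simp]: "\<omega> \<in> space P \<Longrightarrow> \<theta> s (\<theta> t \<omega>) = \<theta> (s + t) \<omega>"
  using flow by (auto simp: measurable_flow_def)

text \<open>Stationarity speaks of images, the change of variables of preimages. The flow maps are
  bijections, so the preimage under \<open>\<theta> s\<close> is the image under
  \<open>\<theta> (- s)\<close>, and \<open>P\<close> is its own image measure.\<close>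

lemma nn_integral_flow:
  assumes "f \<in> borel_measurable P"
  shows "(\<integral>\<^sup>+\<omega>. f (\<theta> s \<omega>) \<partial>P) = (\<integral>\<^sup>+\<omega>. f \<omega> \<partial>P)"
proof -
  have \<theta>: "\<theta> s \<in> P \<rightarrow>\<^sub>M P"
    using measurable_flow_compose[of "\<lambda>_. s" P "\<lambda>x. x"] by simp
  have "distr P P (\<theta> s) = P"
  proof (rule measure_eqI)
    fix A assume "A \<in> sets (distr P P (\<theta> s))"
    then have A: "A \<in> sets P" by simp
    have "\<theta> s -` A \<inter> space P = \<theta> (- s) ` A"
    proof (intro equalityI subsetI)
      fix x assume "x \<in> \<theta> s -` A \<inter> space P"
      then show "x \<in> \<theta> (- s) ` A" by (intro image_eqI[of _ _ "\<theta> s x"]) auto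
    next
      fix x assume "x \<in> \<theta> (- s) ` A"
      then show "x \<in> \<theta> s -` A \<inter> space P" using sets.sets_into_space[OF A] by auto
    qed
    then show "emeasure (distr P P (\<theta> s)) A = emeasure P A"
      using stationary A by (simp add: emeasure_distr[OF \<theta>] stationary_def)
  qed simp
  then show ?thesis using nn_integral_distr[OF \<theta>, of f] assms by simp
qed

lemmas borel_measurable_kernel =
  random_measure_nn_integral_compose[OF locally_compact]

text \<open>Translation of integrals for the pair of measures at \<omega> and at its shift by
  \<open>u\<close>: a shift of the sample point becomes a shift of the integration variable.\<close>

lemma nn_integral_invariant:
  assumes "random_measure P \<kappa>" "invariant_measure P \<theta> \<kappa>" "\<omega> \<in> space P"
    and "f \<in> borel_measurable borel"
  shows "(\<integral>\<^sup>+s. f s \<partial>\<kappa> (\<theta> u \<omega>)) = (\<integral>\<^sup>+s. f (s - u) \<partial>\<kappa> \<omega>)"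
  using assms(2,3)
  by (intro nn_integral_translate random_measure_sets[OF assms(1)] assms) (auto simp: invariant_measure_def)

text \<open>The defining formula of the Palm measure, extended from indicators to nonnegative
  functions by linearity and monotone convergence in all three integrals.\<close>

lemma nn_integral_palm_measure:
  assumes \<kappa>: "random_measure P \<kappa>" and B[measurable]: "B \<in> sets borel"
    and f: "f \<in> borel_measurable P"
  shows "(\<integral>\<^sup>+\<omega>. f \<omega> \<partial>palm_measure P \<theta> \<nu> B \<kappa>) =
    inverse (emeasure \<nu> B) * (\<integral>\<^sup>+\<omega>. \<integral>\<^sup>+s. f (\<theta> s \<omega>) * indicator B s \<partial>\<kappa> \<omega> \<partial>P)"
proof -
  note [measurable (raw)] = borel_measurable_kernel[OF \<kappa>]
  let ?c = "inverse (emeasure \<nu> B)"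
  let ?Q = "palm_measure P \<theta> \<nu> B \<kappa>"
  have sets_Q[measurable_cong]: "sets ?Q = sets P"
    by (simp add: palm_measure_def sets.sets_measure_of_eq)
  then have space_Q: "space ?Q = space P" by (rule sets_eq_imp_space_eq)
  have sec: "(\<lambda>s. g (\<theta> s \<omega>) * indicator B s) \<in> borel_measurable (\<kappa> \<omega>)"
    if "\<omega> \<in> space P" "g \<in> borel_measurable P" for g :: "'w \<Rightarrow> ennreal" and \<omega>
  proof -
    note [measurable] = that(2)
    have "(\<lambda>(\<omega>, s). g (\<theta> s \<omega>) * indicator B s) \<in> borel_measurable (P \<Otimes>\<^sub>M borel)"
      by measurable
    from random_measure_section_measurable[OF \<kappa> that(1) this] show ?thesis by simp
  qed
  \<comment> \<open>\<open>measure_of\<close> falls back to the zero measure unless the given set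
    function is a measure, so countable additivity comes before the formula can be read off.\<close>
  have em: "emeasure ?Q A = ?c * (\<integral>\<^sup>+\<omega>. \<integral>\<^sup>+s. indicator A (\<theta> s \<omega>) * indicator B s \<partial>\<kappa> \<omega> \<partial>P)"
    if "A \<in> sets P" for A
    unfolding palm_measure_def
  proof (rule emeasure_measure_of_sigma)
    show "countably_additive (sets P) (\<lambda>A. ?c * (\<integral>\<^sup>+\<omega>. \<integral>\<^sup>+s. indicator A (\<theta> s \<omega>) * indicator B s \<partial>\<kappa> \<omega> \<partial>P))"
    proof (rule countably_additiveI)
      fix A :: "nat \<Rightarrow> 'w set" assume A: "range A \<subseteq> sets P" "disjoint_family A"
      then have [measurable]: "A i \<in> sets P" for i by auto
      have "(\<Sum>i. ?c * (\<integral>\<^sup>+\<omega>. \<integral>\<^sup>+s. indicator (A i) (\<theta> s \<omega>) * indicator B s \<partial>\<kappa> \<omega> \<partial>P))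
        = ?c * (\<integral>\<^sup>+\<omega>. (\<Sum>i. \<integral>\<^sup>+s. indicator (A i) (\<theta> s \<omega>) * indicator B s \<partial>\<kappa> \<omega>) \<partial>P)"
        by (subst nn_integral_suminf) auto
      also have "(\<integral>\<^sup>+\<omega>. (\<Sum>i. \<integral>\<^sup>+s. indicator (A i) (\<theta> s \<omega>) * indicator B s \<partial>\<kappa> \<omega>) \<partial>P)
        = (\<integral>\<^sup>+\<omega>. \<integral>\<^sup>+s. indicator (\<Union>i. A i) (\<theta> s \<omega>) * indicator B s \<partial>\<kappa> \<omega> \<partial>P)"
      proof (rule nn_integral_cong)
        fix \<omega> assume \<omega>: "\<omega> \<in> space P"
        have "(\<Sum>i. \<integral>\<^sup>+s. indicator (A i) (\<theta> s \<omega>) * indicator B s \<partial>\<kappa> \<omega>)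
          = (\<integral>\<^sup>+s. (\<Sum>i. indicator (A i) (\<theta> s \<omega>) * indicator B s) \<partial>\<kappa> \<omega>)"
          by (intro nn_integral_suminf[symmetric] sec[OF \<omega>]) simp
        also have "\<dots> = (\<integral>\<^sup>+s. indicator (\<Union>i. A i) (\<theta> s \<omega>) * indicator B s \<partial>\<kappa> \<omega>)"
          by (simp add: suminf_indicator[OF A(2)])
        finally show "(\<Sum>i. \<integral>\<^sup>+s. indicator (A i) (\<theta> s \<omega>) * indicator B s \<partial>\<kappa> \<omega>) = \<dots>" .
      qed
      finally show "(\<Sum>i. ?c * (\<integral>\<^sup>+\<omega>. \<integral>\<^sup>+s. indicator (A i) (\<theta> s \<omega>) * indicator B s \<partial>\<kappa> \<omega> \<partial>P))
        = ?c * (\<integral>\<^sup>+\<omega>. \<integral>\<^sup>+s. indicator (\<Union>i. A i) (\<theta> s \<omega>) * indicator B s \<partial>\<kappa> \<omega> \<partial>P)" .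
    qed
  qed (use that in \<open>auto simp: positive_def sets.sigma_algebra_axioms\<close>)
  show ?thesis
    using f
  proof (induct f rule: borel_measurable_induct)
    case (cong f g)
    then have "(\<integral>\<^sup>+\<omega>. f \<omega> \<partial>?Q) = (\<integral>\<^sup>+\<omega>. g \<omega> \<partial>?Q)"
      by (intro nn_integral_cong) (simp add: space_Q)
    moreover have "(\<integral>\<^sup>+\<omega>. \<integral>\<^sup>+s. f (\<theta> s \<omega>) * indicator B s \<partial>\<kappa> \<omega> \<partial>P)
        = (\<integral>\<^sup>+\<omega>. \<integral>\<^sup>+s. g (\<theta> s \<omega>) * indicator B s \<partial>\<kappa> \<omega> \<partial>P)"
      using cong by (intro nn_integral_cong) simp
    ultimately show ?case using cong by simp
  next
    case (set A)
    then show ?case using em by (simp add: sets_Q)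
  next
    case (mult f c)
    note [measurable] = mult(2)
    have "(\<integral>\<^sup>+\<omega>. \<integral>\<^sup>+s. c * f (\<theta> s \<omega>) * indicator B s \<partial>\<kappa> \<omega> \<partial>P)
        = (\<integral>\<^sup>+\<omega>. c * (\<integral>\<^sup>+s. f (\<theta> s \<omega>) * indicator B s \<partial>\<kappa> \<omega>) \<partial>P)"
      by (intro nn_integral_cong) (simp add: mult.assoc nn_integral_cmult sec)
    also have "\<dots> = c * (\<integral>\<^sup>+\<omega>. \<integral>\<^sup>+s. f (\<theta> s \<omega>) * indicator B s \<partial>\<kappa> \<omega> \<partial>P)"
      by (intro nn_integral_cmult) measurable
    finally show ?case using mult(4) by (simp add: nn_integral_cmult ac_simps)
  next
    case (add f g)
    note [measurable] = add(1,4)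
    have "(\<integral>\<^sup>+\<omega>. \<integral>\<^sup>+s. (g (\<theta> s \<omega>) + f (\<theta> s \<omega>)) * indicator B s \<partial>\<kappa> \<omega> \<partial>P)
        = (\<integral>\<^sup>+\<omega>. (\<integral>\<^sup>+s. g (\<theta> s \<omega>) * indicator B s \<partial>\<kappa> \<omega>) + (\<integral>\<^sup>+s. f (\<theta> s \<omega>) * indicator B s \<partial>\<kappa> \<omega>) \<partial>P)"
      by (intro nn_integral_cong) (simp add: distrib_right nn_integral_add sec)
    also have "\<dots> = (\<integral>\<^sup>+\<omega>. \<integral>\<^sup>+s. g (\<theta> s \<omega>) * indicator B s \<partial>\<kappa> \<omega> \<partial>P) + (\<integral>\<^sup>+\<omega>. \<integral>\<^sup>+s. f (\<theta> s \<omega>) * indicator B s \<partial>\<kappa> \<omega> \<partial>P)"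
      by (intro nn_integral_add) measurable
    finally show ?case using add(3,7) by (simp add: nn_integral_add distrib_left)
  next
    case (seq U)
    note [measurable] = seq(1)
    have "(\<integral>\<^sup>+\<omega>. \<integral>\<^sup>+s. (SUP i. U i (\<theta> s \<omega>)) * indicator B s \<partial>\<kappa> \<omega> \<partial>P)
        = (\<integral>\<^sup>+\<omega>. (SUP i. \<integral>\<^sup>+s. U i (\<theta> s \<omega>) * indicator B s \<partial>\<kappa> \<omega>) \<partial>P)"
    proof (rule nn_integral_cong)
      fix \<omega> assume \<omega>: "\<omega> \<in> space P"
      have "(\<integral>\<^sup>+s. (SUP i. U i (\<theta> s \<omega>)) * indicator B s \<partial>\<kappa> \<omega>)
          = (\<integral>\<^sup>+s. (SUP i. U i (\<theta> s \<omega>) * indicator B s) \<partial>\<kappa> \<omega>)"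
        by (simp add: SUP_mult_right_ennreal)
      also have "\<dots> = (SUP i. \<integral>\<^sup>+s. U i (\<theta> s \<omega>) * indicator B s \<partial>\<kappa> \<omega>)"
        using seq(4) by (intro nn_integral_monotone_convergence_SUP sec[OF \<omega>])
          (auto simp: incseq_def le_fun_def intro!: mult_right_mono)
      finally show "(\<integral>\<^sup>+s. (SUP i. U i (\<theta> s \<omega>)) * indicator B s \<partial>\<kappa> \<omega>) = \<dots>" .
    qed
    also have "\<dots> = (SUP i. \<integral>\<^sup>+\<omega>. \<integral>\<^sup>+s. U i (\<theta> s \<omega>) * indicator B s \<partial>\<kappa> \<omega> \<partial>P)"
      using seq(4) by (intro nn_integral_monotone_convergence_SUP)
        (auto simp: incseq_def le_fun_def intro!: nn_integral_mono mult_right_mono)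
    also have "?c * \<dots> = (SUP i. \<integral>\<^sup>+\<omega>. U i \<omega> \<partial>?Q)"
      by (simp add: seq(3) SUP_mult_left_ennreal)
    also have "\<dots> = (\<integral>\<^sup>+\<omega>. (SUP i. U i \<omega>) \<partial>?Q)"
      using seq(4) by (intro nn_integral_monotone_convergence_SUP[symmetric]) auto
    finally show ?case by (simp add: SUP_apply image_comp)
  qed
qed

section \<open>Exchange of integrals and the mass transport principle\<close>

text \<open>Tonelli for one fixed realisation of the kernel. The second measure will be either Haar
  measure or a realisation of the point process.\<close>

lemma nn_integral_kernel_Fubini:
  assumes \<kappa>: "random_measure N \<kappa>" "x \<in> space N" and \<rho>: "sigma_finite_measure \<rho>" "sets \<rho> = sets borel"
    and f: "(\<lambda>(s :: 'g, t :: 'g). f s t) \<in> borel_measurable (borel \<Otimes>\<^sub>M borel)"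
  shows "(\<integral>\<^sup>+s. \<integral>\<^sup>+t. f s t \<partial>\<rho> \<partial>\<kappa> x) = (\<integral>\<^sup>+t. \<integral>\<^sup>+s. f s t \<partial>\<kappa> x \<partial>\<rho>)"
proof -
  interpret pair_sigma_finite "\<kappa> x" \<rho>
    using random_measure_sigma_finite[OF locally_compact \<kappa>] \<rho>(1) by (simp add: pair_sigma_finite_def)
  have "sets (\<kappa> x \<Otimes>\<^sub>M \<rho>) = sets (borel \<Otimes>\<^sub>M borel)"
    by (intro sets_pair_measure_cong random_measure_sets[OF \<kappa>] \<rho>(2))
  from measurable_cong_sets[OF this refl] f
  have "case_prod f \<in> borel_measurable (\<kappa> x \<Otimes>\<^sub>M \<rho>)" by auto
  then show ?thesis by (rule Fubini'[symmetric])
qed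

text \<open>Stationarity lets the sample point be shifted by \<open>u\<close> under the integral
  over \<open>P\<close>. Invariance of both random measures moves the shift into \<open>s\<close>
  and \<open>t\<close>, and \<open>F\<close> absorbs it, so that only the weight \<open>g\<close>
  changes.\<close>

lemma nn_integral_diagonal_shift:
  assumes \<xi>: "random_measure P \<xi>" "invariant_measure P \<theta> \<xi>"
    and \<eta>: "random_measure P \<eta>" "invariant_measure P \<theta> \<eta>"
    and F: "(\<lambda>(\<omega>, s, t). F \<omega> s t) \<in> borel_measurable (P \<Otimes>\<^sub>M borel \<Otimes>\<^sub>M borel)"
    and inv: "\<And>\<omega> s t. \<omega> \<in> space P \<Longrightarrow> F (\<theta> u \<omega>) (s - u) (t - u) = F \<omega> s t"
    and g: "(\<lambda>(s, t). g s t) \<in> borel_measurable (borel \<Otimes>\<^sub>M borel)"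
  shows "(\<integral>\<^sup>+\<omega>. \<integral>\<^sup>+s. \<integral>\<^sup>+t. g (s - u) (t - u) * F \<omega> s t \<partial>\<eta> \<omega> \<partial>\<xi> \<omega> \<partial>P) =
    (\<integral>\<^sup>+\<omega>. \<integral>\<^sup>+s. \<integral>\<^sup>+t. g s t * F \<omega> s t \<partial>\<eta> \<omega> \<partial>\<xi> \<omega> \<partial>P)"
proof -
  note [measurable (raw)] = borel_measurable_kernel[OF \<xi>(1)] borel_measurable_kernel[OF \<eta>(1)]
    measurable_curry3[OF F] measurable_curry2[OF g]
  let ?\<Phi> = "\<lambda>\<omega>. \<integral>\<^sup>+s. \<integral>\<^sup>+t. g s t * F \<omega> s t \<partial>\<eta> \<omega> \<partial>\<xi> \<omega>"
  have shift: "?\<Phi> (\<theta> u \<omega>) = (\<integral>\<^sup>+s. \<integral>\<^sup>+t. g (s - u) (t - u) * F \<omega> s t \<partial>\<eta> \<omega> \<partial>\<xi> \<omega>)"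
    if \<omega>: "\<omega> \<in> space P" for \<omega>
  proof -
    have "?\<Phi> (\<theta> u \<omega>) = (\<integral>\<^sup>+s. \<integral>\<^sup>+t. g (s - u) t * F (\<theta> u \<omega>) (s - u) t \<partial>\<eta> (\<theta> u \<omega>) \<partial>\<xi> \<omega>)"
    proof (rule nn_integral_invariant[OF \<xi> \<omega>])
      have "(\<lambda>_::'g. \<theta> u \<omega>) \<in> borel \<rightarrow>\<^sub>M P" using \<omega> by simp
      then show "(\<lambda>s. \<integral>\<^sup>+t. g s t * F (\<theta> u \<omega>) s t \<partial>\<eta> (\<theta> u \<omega>)) \<in> borel_measurable borel"
        by measurable
    qed
    also have "\<dots> = (\<integral>\<^sup>+s. \<integral>\<^sup>+t. g (s - u) (t - u) * F (\<theta> u \<omega>) (s - u) (t - u) \<partial>\<eta> \<omega> \<partial>\<xi> \<omega>)"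
    proof (intro nn_integral_cong nn_integral_invariant[OF \<eta> \<omega>])
      fix s
      have "(\<lambda>_::'g. \<theta> u \<omega>) \<in> borel \<rightarrow>\<^sub>M P" using \<omega> by simp
      then show "(\<lambda>t. g (s - u) t * F (\<theta> u \<omega>) (s - u) t) \<in> borel_measurable borel"
        by measurable
    qed
    finally show ?thesis by (simp add: inv[OF \<omega>])
  qed
  have "(\<integral>\<^sup>+\<omega>. ?\<Phi> (\<theta> u \<omega>) \<partial>P) = (\<integral>\<^sup>+\<omega>. ?\<Phi> \<omega> \<partial>P)"
    by (rule nn_integral_flow) measurable
  then show ?thesis by (simp add: shift cong: nn_integral_cong)
qed

text \<open>The integral over \<open>u\<close> moves outward by three Tonelli exchanges: past the
  two kernels for fixed \<omega>, then past \<open>P\<close> by sigma-finiteness.\<close>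

lemma nn_integral_kernels_Fubini:
  fixes \<xi> \<eta> :: "'w \<Rightarrow> 'g measure"
  assumes \<xi>: "random_measure P \<xi>" and \<eta>: "random_measure P \<eta>"
    and \<rho>: "sigma_finite_measure \<rho>" and sets_\<rho>[measurable_cong]: "sets \<rho> = sets (borel :: 'g measure)"
    and k: "(\<lambda>(\<omega>, s, t, u). k \<omega> s t u) \<in> borel_measurable (P \<Otimes>\<^sub>M borel \<Otimes>\<^sub>M borel \<Otimes>\<^sub>M borel)"
  shows "(\<integral>\<^sup>+\<omega>. \<integral>\<^sup>+s. \<integral>\<^sup>+t. \<integral>\<^sup>+u. k \<omega> s t u \<partial>\<rho> \<partial>\<eta> \<omega> \<partial>\<xi> \<omega> \<partial>P) =
    (\<integral>\<^sup>+u. \<integral>\<^sup>+\<omega>. \<integral>\<^sup>+s. \<integral>\<^sup>+t. k \<omega> s t u \<partial>\<eta> \<omega> \<partial>\<xi> \<omega> \<partial>P \<partial>\<rho>)"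
proof -
  note [measurable (raw)] = borel_measurable_kernel[OF \<xi>] borel_measurable_kernel[OF \<eta>]
    measurable_curry4[OF k]
  interpret \<rho>: sigma_finite_measure \<rho> by fact
  interpret pair_sigma_finite P \<rho> ..
  have "(\<integral>\<^sup>+\<omega>. \<integral>\<^sup>+s. \<integral>\<^sup>+t. \<integral>\<^sup>+u. k \<omega> s t u \<partial>\<rho> \<partial>\<eta> \<omega> \<partial>\<xi> \<omega> \<partial>P)
    = (\<integral>\<^sup>+\<omega>. \<integral>\<^sup>+u. \<integral>\<^sup>+s. \<integral>\<^sup>+t. k \<omega> s t u \<partial>\<eta> \<omega> \<partial>\<xi> \<omega> \<partial>\<rho> \<partial>P)"
  proof (rule nn_integral_cong)
    fix \<omega> assume \<omega>[simp]: "\<omega> \<in> space P"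
    have const[measurable]: "(\<lambda>_. \<omega>) \<in> M \<rightarrow>\<^sub>M P" for M :: "('g \<times> 'g) measure" by simp
    have "(\<integral>\<^sup>+s. \<integral>\<^sup>+t. \<integral>\<^sup>+u. k \<omega> s t u \<partial>\<rho> \<partial>\<eta> \<omega> \<partial>\<xi> \<omega>) = (\<integral>\<^sup>+s. \<integral>\<^sup>+u. \<integral>\<^sup>+t. k \<omega> s t u \<partial>\<eta> \<omega> \<partial>\<rho> \<partial>\<xi> \<omega>)"
      by (intro nn_integral_cong nn_integral_kernel_Fubini[OF \<eta> \<omega> \<rho> sets_\<rho>]) measurable
    also have "\<dots> = (\<integral>\<^sup>+u. \<integral>\<^sup>+s. \<integral>\<^sup>+t. k \<omega> s t u \<partial>\<eta> \<omega> \<partial>\<xi> \<omega> \<partial>\<rho>)"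
      by (intro nn_integral_kernel_Fubini[OF \<xi> \<omega> \<rho> sets_\<rho>]) measurable
    finally show "(\<integral>\<^sup>+s. \<integral>\<^sup>+t. \<integral>\<^sup>+u. k \<omega> s t u \<partial>\<rho> \<partial>\<eta> \<omega> \<partial>\<xi> \<omega>) = \<dots>" .
  qed
  also have "\<dots> = (\<integral>\<^sup>+u. \<integral>\<^sup>+\<omega>. \<integral>\<^sup>+s. \<integral>\<^sup>+t. k \<omega> s t u \<partial>\<eta> \<omega> \<partial>\<xi> \<omega> \<partial>P \<partial>\<rho>)"
    by (rule Fubini'[symmetric]) measurable
  finally show ?thesis .
qed

text \<open>Both sides equal the Haar integral over \<open>u\<close> of the triple integral with
  weight \<open>indicator B s * indicator B' (t + u)\<close>. Integrating out \<open>u\<close> at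
  once gives the left side; a diagonal shift by \<open>u\<close> beforehand gives the right
  side.\<close>

lemma mass_transport:
  assumes \<nu>: "haar_measure \<nu>"
    and \<xi>: "random_measure P \<xi>" "invariant_measure P \<theta> \<xi>"
    and \<eta>: "random_measure P \<eta>" "invariant_measure P \<theta> \<eta>"
    and F: "(\<lambda>(\<omega>, s, t). F \<omega> s t) \<in> borel_measurable (P \<Otimes>\<^sub>M borel \<Otimes>\<^sub>M borel)"
    and inv: "\<And>\<omega> s t u. \<omega> \<in> space P \<Longrightarrow> F (\<theta> u \<omega>) (s - u) (t - u) = F \<omega> s t"
    and B[measurable]: "B \<in> sets borel" and B'[measurable]: "B' \<in> sets borel"
    and pos: "0 < emeasure \<nu> B'" "emeasure \<nu> B' < \<infinity>"
  shows "emeasure \<nu> B' * (\<integral>\<^sup>+\<omega>. \<integral>\<^sup>+s. \<integral>\<^sup>+t. indicator B s * F \<omega> s t \<partial>\<eta> \<omega> \<partial>\<xi> \<omega> \<partial>P) =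
    emeasure \<nu> B * (\<integral>\<^sup>+\<omega>. \<integral>\<^sup>+s. \<integral>\<^sup>+t. indicator B' t * F \<omega> s t \<partial>\<eta> \<omega> \<partial>\<xi> \<omega> \<partial>P)"
proof -
  have sets_\<nu>[measurable_cong]: "sets \<nu> = sets borel" using \<nu> by (simp add: haar_measure_def)
  have sf: "sigma_finite_measure \<nu>"
    using \<nu> by (intro sigma_finite_locally_finite[OF locally_compact]) (auto simp: haar_measure_def)
  note [measurable (raw)] = borel_measurable_kernel[OF \<xi>(1)] borel_measurable_kernel[OF \<eta>(1)]
    measurable_curry3[OF F]
  \<comment> \<open>With the random measures and \<open>F\<close> held fixed, the whole argument
    concerns the weight \<open>g\<close> alone.\<close>
  define J where "J g = (\<integral>\<^sup>+\<omega>. \<integral>\<^sup>+s. \<integral>\<^sup>+t. g s t * F \<omega> s t \<partial>\<eta> \<omega> \<partial>\<xi> \<omega> \<partial>P)" for g :: "'g \<Rightarrow> 'g \<Rightarrow> ennreal"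
  have J_cmult: "c * J g = J (\<lambda>s t. c * g s t)"
    if g: "(\<lambda>(s, t). g s t) \<in> borel_measurable (borel \<Otimes>\<^sub>M borel)" for c g
  proof -
    note [measurable (raw)] = measurable_curry2[OF g]
    have "(\<integral>\<^sup>+s. \<integral>\<^sup>+t. c * g s t * F \<omega> s t \<partial>\<eta> \<omega> \<partial>\<xi> \<omega>) = c * (\<integral>\<^sup>+s. \<integral>\<^sup>+t. g s t * F \<omega> s t \<partial>\<eta> \<omega> \<partial>\<xi> \<omega>)"
      if \<omega>[simp]: "\<omega> \<in> space P" for \<omega>
    proof -
      have [measurable]: "(\<lambda>_. \<omega>) \<in> M \<rightarrow>\<^sub>M P" for M :: "'g measure" by simp
      note [measurable_cong] = random_measure_sets[OF \<xi>(1) \<omega>] random_measure_sets[OF \<eta>(1) \<omega>]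
      show ?thesis by (simp add: nn_integral_cmult[symmetric] mult.assoc)
    qed
    then show ?thesis
      unfolding J_def by (simp add: nn_integral_cmult[symmetric] cong: nn_integral_cong)
  qed
  have J_nn: "J (\<lambda>s t. \<integral>\<^sup>+u. k s t u \<partial>\<nu>) = (\<integral>\<^sup>+u. J (\<lambda>s t. k s t u) \<partial>\<nu>)"
    if k: "(\<lambda>(s, t, u). k s t u) \<in> borel_measurable (borel \<Otimes>\<^sub>M borel \<Otimes>\<^sub>M borel)" for k
  proof -
    note [measurable (raw)] = measurable_curry3[OF k]
    have "J (\<lambda>s t. \<integral>\<^sup>+u. k s t u \<partial>\<nu>) = (\<integral>\<^sup>+\<omega>. \<integral>\<^sup>+s. \<integral>\<^sup>+t. \<integral>\<^sup>+u. k s t u * F \<omega> s t \<partial>\<nu> \<partial>\<eta> \<omega> \<partial>\<xi> \<omega> \<partial>P)"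
      unfolding J_def by (simp add: nn_integral_multc)
    also have "\<dots> = (\<integral>\<^sup>+u. J (\<lambda>s t. k s t u) \<partial>\<nu>)"
      unfolding J_def by (rule nn_integral_kernels_Fubini[OF \<xi>(1) \<eta>(1) sf sets_\<nu>]) measurable
    finally show ?thesis .
  qed
  have tr: "(\<integral>\<^sup>+u. indicator B' (t + u) \<partial>\<nu>) = emeasure \<nu> B'" for t
    using nn_integral_haar_translate[OF \<nu>, of "indicator B'" "- t"] by (simp add: sets_\<nu> add.commute)
  have meas1: "(\<lambda>(s, t, u). indicator B s * indicator B' (t + u) :: ennreal)
      \<in> borel_measurable (borel \<Otimes>\<^sub>M borel \<Otimes>\<^sub>M borel)"
    by measurable
  have meas2: "(\<lambda>(s, t, u). indicator B (s - u) * indicator B' t :: ennreal)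
      \<in> borel_measurable (borel \<Otimes>\<^sub>M borel \<Otimes>\<^sub>M borel)"
    by measurable
  have meas3: "(\<lambda>(s, t). indicator B s * indicator B' (t + u) :: ennreal)
      \<in> borel_measurable (borel \<Otimes>\<^sub>M borel)" for u
    by measurable
  have "emeasure \<nu> B' * J (\<lambda>s t. indicator B s)
      = J (\<lambda>s t. \<integral>\<^sup>+u. indicator B s * indicator B' (t + u) \<partial>\<nu>)"
    by (simp add: J_cmult nn_integral_cmult tr mult.commute)
  also have "\<dots> = (\<integral>\<^sup>+u. J (\<lambda>s t. indicator B s * indicator B' (t + u)) \<partial>\<nu>)"
    by (rule J_nn[OF meas1])
  \<comment> \<open>The diagonal shift replaces \<open>s\<close> and \<open>t\<close> by
    \<open>s - u\<close> and \<open>t - u\<close>, so the argument of the second indicator becomes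
    \<open>t\<close>.\<close>
  also have "\<dots> = (\<integral>\<^sup>+u. J (\<lambda>s t. indicator B (s - u) * indicator B' t) \<partial>\<nu>)"
  proof (rule nn_integral_cong)
    fix u
    show "J (\<lambda>s t. indicator B s * indicator B' (t + u)) = J (\<lambda>s t. indicator B (s - u) * indicator B' t)"
      using nn_integral_diagonal_shift[where u = u and F = F and g = "\<lambda>s t. indicator B s * indicator B' (t + u)",
        OF \<xi> \<eta> F inv[where u = u] meas3]
      unfolding J_def by simp
  qed
  also have "\<dots> = J (\<lambda>s t. \<integral>\<^sup>+u. indicator B (s - u) * indicator B' t \<partial>\<nu>)"
    by (rule J_nn[OF meas2, symmetric])
  \<comment> \<open>Here \<open>u\<close> enters with a minus sign, so translation invariance alone
    does not suffice and invariance under inversion is used.\<close>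
  also have "\<dots> = emeasure \<nu> B * J (\<lambda>s t. indicator B' t)"
    by (simp add: J_cmult nn_integral_multc nn_integral_haar_reflect[OF locally_compact \<nu> B B' pos])
  finally show ?thesis by (simp add: J_def)
qed

end

section \<open>The exchange formula for two Palm measures\<close>

theorem proposition3p1:
  fixes P :: "'w measure"
    and \<nu> :: "'g::{topological_ab_group_add, second_countable_topology, t2_space} measure"
    and \<theta> :: "'g \<Rightarrow> 'w \<Rightarrow> 'w"
    and \<xi> \<eta> :: "'w \<Rightarrow> 'g measure"
    and \<tau> :: "'w \<Rightarrow> 'g \<Rightarrow> 'g option"
    and h :: "'w \<times> 'w \<Rightarrow> ennreal"
    and B B' :: "'g set"
  assumes "locally_compact_space (euclidean :: 'g topology)"
    and "haar_measure \<nu>"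
    and "sigma_finite_measure P"
    and "measurable_flow P \<theta>"
    and "stationary P \<theta>"
    and "random_measure P \<xi>"
    and "invariant_measure P \<theta> \<xi>"
    and "point_process P \<eta>"
    and "simple_process P \<eta>"
    and "invariant_measure P \<theta> \<eta>"
    and "allocation P \<theta> \<tau>"
    and "AE \<omega> in P. AE s in \<xi> \<omega>. \<tau> \<omega> s \<in> Some ` measure_support (\<eta> \<omega>) \<union> {None}"
    and "h \<in> borel_measurable (P \<Otimes>\<^sub>M P)"
    and "B \<in> sets borel" "0 < emeasure \<nu> B" "emeasure \<nu> B < \<infinity>"
    and "B' \<in> sets borel" "0 < emeasure \<nu> B'" "emeasure \<nu> B' < \<infinity>"
  shows "(\<integral>\<^sup>+\<omega>. (case \<tau> \<omega> 0 of None \<Rightarrow> 0 | Some t \<Rightarrow> h (\<omega>, \<theta> t \<omega>)) \<partial>palm_measure P \<theta> \<nu> B \<xi>) =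
         (\<integral>\<^sup>+\<omega>. (\<integral>\<^sup>+s\<in>allocation_cell \<tau> \<omega> 0. h (\<theta> s \<omega>, \<omega>) \<partial>\<xi> \<omega>) \<partial>palm_measure P \<theta> \<nu> B' \<eta>)"
proof -
  interpret stationary_flow P \<theta>
    using assms(1,3-5) by (simp add: stationary_flow_def stationary_flow_axioms_def)
  note \<xi> = assms(6,7) and \<eta> = point_process_imp_random_measure[OF assms(8)] assms(10)
  note [measurable] = assms(13,14,17)
  note [measurable (raw)] = borel_measurable_kernel[OF \<xi>(1)] borel_measurable_kernel[OF \<eta>(1)]
  have \<tau>: "(\<lambda>(\<omega>, s). \<tau> \<omega> s) \<in> P \<Otimes>\<^sub>M borel \<rightarrow>\<^sub>M extended_borel"
    and cov: "\<And>\<omega> s t. \<omega> \<in> space P \<Longrightarrow> \<tau> (\<theta> t \<omega>) (s - t) = map_option (\<lambda>x. x - t) (\<tau> \<omega> s)"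
    using assms(11) by (auto simp: allocation_def)
  have \<tau>_the[measurable (raw)]: "(\<lambda>x. the (\<tau> (f x) (g x))) \<in> borel_measurable N"
    and \<tau>_None[measurable (raw)]: "Measurable.pred N (\<lambda>x. \<tau> (f x) (g x) = None)"
    if "f \<in> N \<rightarrow>\<^sub>M P" "g \<in> borel_measurable N" for f g and N :: "'n measure"
    using measurable_compose[OF measurable_curry2[OF \<tau> that] measurable_extended_borel_the]
      measurable_compose[OF measurable_curry2[OF \<tau> that] pred_extended_borel_None] by auto
  define F where "F \<omega> s t = (if \<tau> \<omega> s = Some t then h (\<theta> s \<omega>, \<theta> t \<omega>) else 0)" for \<omega> s t
  \<comment> \<open>In this form measurability is automatic: the test for infinity and the equality
    of two group-valued measurable maps are both measurable events.\<close>
  have F_alt: "F = (\<lambda>\<omega> s t. if \<not> \<tau> \<omega> s = None \<and> the (\<tau> \<omega> s) = t then h (\<theta> s \<omega>, \<theta> t \<omega>) else 0)"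
    by (auto simp: F_def fun_eq_iff)
  have F: "(\<lambda>(\<omega>, s, t). F \<omega> s t) \<in> borel_measurable (P \<Otimes>\<^sub>M borel \<Otimes>\<^sub>M borel)"
    unfolding F_alt by measurable
  note [measurable (raw)] = measurable_curry3[OF F]
  \<comment> \<open>Covariance shifts the allocated point by \<open>u\<close> along with
    \<open>t\<close>, and the flow property cancels \<open>u\<close> in both arguments of
    \<open>h\<close>.\<close>
  have F_inv: "F (\<theta> u \<omega>) (s - u) (t - u) = F \<omega> s t" if "\<omega> \<in> space P" for \<omega> s t u
    using that by (cases "\<tau> \<omega> s") (auto simp: F_def cov)
  have "(\<integral>\<^sup>+\<omega>. (case \<tau> \<omega> 0 of None \<Rightarrow> 0 | Some t \<Rightarrow> h (\<omega>, \<theta> t \<omega>)) \<partial>palm_measure P \<theta> \<nu> B \<xi>)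
    = inverse (emeasure \<nu> B) * (\<integral>\<^sup>+\<omega>. \<integral>\<^sup>+s. indicator B s * (case \<tau> \<omega> s of None \<Rightarrow> 0 | Some t \<Rightarrow> h (\<theta> s \<omega>, \<theta> t \<omega>)) \<partial>\<xi> \<omega> \<partial>P)"
  proof (subst nn_integral_palm_measure[OF \<xi>(1) assms(14)])
    have "(\<lambda>\<omega>. case \<tau> \<omega> 0 of None \<Rightarrow> 0 | Some t \<Rightarrow> h (\<omega>, \<theta> t \<omega>))
        = (\<lambda>\<omega>. if \<tau> \<omega> 0 = None then 0 else h (\<omega>, \<theta> (the (\<tau> \<omega> 0)) \<omega>))"
      by (auto simp: fun_eq_iff split: option.split)
    also have "\<dots> \<in> borel_measurable P" by measurable
    finally show "(\<lambda>\<omega>. case \<tau> \<omega> 0 of None \<Rightarrow> 0 | Some t \<Rightarrow> h (\<omega>, \<theta> t \<omega>)) \<in> borel_measurable P" .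
    \<comment> \<open>Covariance with both parameters equal to \<open>s\<close> turns the value at
      the origin for the shifted sample into \<open>\<tau> \<omega> s\<close> minus
      \<open>s\<close>; composing the flow maps cancels this \<open>s\<close>.\<close>
    have "(case \<tau> (\<theta> s \<omega>) 0 of None \<Rightarrow> 0 | Some t \<Rightarrow> h (\<theta> s \<omega>, \<theta> t (\<theta> s \<omega>)))
        = (case \<tau> \<omega> s of None \<Rightarrow> 0 | Some t \<Rightarrow> h (\<theta> s \<omega>, \<theta> t \<omega>))" if "\<omega> \<in> space P" for \<omega> s
      using that cov[OF that, of s s] by (cases "\<tau> \<omega> s") auto
    then show "inverse (emeasure \<nu> B) * (\<integral>\<^sup>+\<omega>. \<integral>\<^sup>+s. (case \<tau> (\<theta> s \<omega>) 0 of None \<Rightarrow> 0 | Some t \<Rightarrow> h (\<theta> s \<omega>, \<theta> t (\<theta> s \<omega>))) * indicator B s \<partial>\<xi> \<omega> \<partial>P)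
      = inverse (emeasure \<nu> B) * (\<integral>\<^sup>+\<omega>. \<integral>\<^sup>+s. indicator B s * (case \<tau> \<omega> s of None \<Rightarrow> 0 | Some t \<Rightarrow> h (\<theta> s \<omega>, \<theta> t \<omega>)) \<partial>\<xi> \<omega> \<partial>P)"
      by (simp add: mult.commute cong: nn_integral_cong)
  qed
  \<comment> \<open>The integral over \<open>\<eta> \<omega>\<close> is introduced. It returns the
    value at the allocated point because that point is an atom of mass one, which holds only almost
    everywhere, first in \<omega> and then in \<open>s\<close>.\<close>
  also have "(\<integral>\<^sup>+\<omega>. \<integral>\<^sup>+s. indicator B s * (case \<tau> \<omega> s of None \<Rightarrow> 0 | Some t \<Rightarrow> h (\<theta> s \<omega>, \<theta> t \<omega>)) \<partial>\<xi> \<omega> \<partial>P)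
    = (\<integral>\<^sup>+\<omega>. \<integral>\<^sup>+s. \<integral>\<^sup>+t. indicator B s * F \<omega> s t \<partial>\<eta> \<omega> \<partial>\<xi> \<omega> \<partial>P)"
  proof (rule nn_integral_cong_AE)
    have "(\<integral>\<^sup>+s. indicator B s * (case \<tau> \<omega> s of None \<Rightarrow> 0 | Some t \<Rightarrow> h (\<theta> s \<omega>, \<theta> t \<omega>)) \<partial>\<xi> \<omega>)
      = (\<integral>\<^sup>+s. \<integral>\<^sup>+t. indicator B s * F \<omega> s t \<partial>\<eta> \<omega> \<partial>\<xi> \<omega>)"
      if \<omega>: "\<omega> \<in> space P" and AE: "AE s in \<xi> \<omega>. \<tau> \<omega> s \<in> Some ` measure_support (\<eta> \<omega>) \<union> {None}" for \<omega>
    proof (rule nn_integral_cong_AE)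
      have sets: "sets (\<eta> \<omega>) = sets borel" using \<eta>(1) \<omega> by (rule random_measure_sets)
      have atom: "emeasure (\<eta> \<omega>) {t} = 1" if "t \<in> measure_support (\<eta> \<omega>)" for t
      proof (rule measure_support_atom[OF assms(1) _ _ that])
        show "\<eta> \<omega> \<in> counting_measures"
          using measurable_space[OF assms(8)[unfolded point_process_def] \<omega>]
          by (simp add: space_restrict_space)
        show "emeasure (\<eta> \<omega>) {t} \<le> 1"
          using assms(9) \<omega> by (simp add: simple_process_def)
      qed
      have "indicator B s * (case \<tau> \<omega> s of None \<Rightarrow> 0 | Some t \<Rightarrow> h (\<theta> s \<omega>, \<theta> t \<omega>))
          = (\<integral>\<^sup>+t. indicator B s * F \<omega> s t \<partial>\<eta> \<omega>)"
        if s: "\<tau> \<omega> s \<in> Some ` measure_support (\<eta> \<omega>) \<union> {None}" for s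
      proof (cases "\<tau> \<omega> s")
        case None
        then show ?thesis by (simp add: F_def)
      next
        case (Some r)
        then have "(\<integral>\<^sup>+t. indicator B s * F \<omega> s t \<partial>\<eta> \<omega>)
          = (\<integral>\<^sup>+t. (indicator B s * h (\<theta> s \<omega>, \<theta> t \<omega>)) * indicator {r} t \<partial>\<eta> \<omega>)"
          by (intro nn_integral_cong) (auto simp: F_def indicator_def)
        also have "\<dots> = indicator B s * h (\<theta> s \<omega>, \<theta> r \<omega>) * emeasure (\<eta> \<omega>) {r}"
          by (rule nn_integral_indicator_singleton) (simp add: sets)
        also have "emeasure (\<eta> \<omega>) {r} = 1" using s Some by (intro atom) auto
        finally show ?thesis using Some by simp
      qed
      with AE show "AE s in \<xi> \<omega>. indicator B s * (case \<tau> \<omega> s of None \<Rightarrow> 0 | Some t \<Rightarrow> h (\<theta> s \<omega>, \<theta> t \<omega>))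
          = (\<integral>\<^sup>+t. indicator B s * F \<omega> s t \<partial>\<eta> \<omega>)"
        by (auto elim: eventually_mono)
    qed
    with assms(12) AE_space
    show "AE \<omega> in P. (\<integral>\<^sup>+s. indicator B s * (case \<tau> \<omega> s of None \<Rightarrow> 0 | Some t \<Rightarrow> h (\<theta> s \<omega>, \<theta> t \<omega>)) \<partial>\<xi> \<omega>)
      = (\<integral>\<^sup>+s. \<integral>\<^sup>+t. indicator B s * F \<omega> s t \<partial>\<eta> \<omega> \<partial>\<xi> \<omega>)"
      by (rule eventually_elim2)
  qed
  also have "inverse (emeasure \<nu> B) * \<dots>
    = inverse (emeasure \<nu> B') * (\<integral>\<^sup>+\<omega>. \<integral>\<^sup>+s. \<integral>\<^sup>+t. indicator B' t * F \<omega> s t \<partial>\<eta> \<omega> \<partial>\<xi> \<omega> \<partial>P)"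
    by (rule ennreal_divide_cross[OF mass_transport[OF assms(2) \<xi> \<eta> F F_inv assms(14,17-19)] assms(15,16,18,19)])
  \<comment> \<open>For each \<omega> the two kernels change places, and everything is then
    recentred at the target \<open>t\<close>, to match the Palm formula for \<eta>.\<close>
  also have "(\<integral>\<^sup>+\<omega>. \<integral>\<^sup>+s. \<integral>\<^sup>+t. indicator B' t * F \<omega> s t \<partial>\<eta> \<omega> \<partial>\<xi> \<omega> \<partial>P)
    = (\<integral>\<^sup>+\<omega>. \<integral>\<^sup>+t. (\<integral>\<^sup>+s\<in>allocation_cell \<tau> (\<theta> t \<omega>) 0. h (\<theta> s (\<theta> t \<omega>), \<theta> t \<omega>) \<partial>\<xi> (\<theta> t \<omega>)) * indicator B' t \<partial>\<eta> \<omega> \<partial>P)"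
  proof (rule nn_integral_cong)
    fix \<omega> assume \<omega>[simp]: "\<omega> \<in> space P"
    have [measurable]: "(\<lambda>_. \<omega>) \<in> M \<rightarrow>\<^sub>M P" for M :: "('g \<times> 'g) measure" by simp
    have [measurable]: "(\<lambda>_. \<omega>) \<in> M \<rightarrow>\<^sub>M P" for M :: "'g measure" by simp
    have "(\<integral>\<^sup>+s. \<integral>\<^sup>+t. indicator B' t * F \<omega> s t \<partial>\<eta> \<omega> \<partial>\<xi> \<omega>) = (\<integral>\<^sup>+t. \<integral>\<^sup>+s. indicator B' t * F \<omega> s t \<partial>\<xi> \<omega> \<partial>\<eta> \<omega>)"
      by (intro nn_integral_kernel_Fubini[OF \<xi>(1) \<omega>] random_measure_sets[OF \<eta>(1) \<omega>]
        random_measure_sigma_finite[OF assms(1) \<eta>(1) \<omega>]) measurable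
    also have "\<dots> = (\<integral>\<^sup>+t. (\<integral>\<^sup>+s\<in>allocation_cell \<tau> (\<theta> t \<omega>) 0. h (\<theta> s (\<theta> t \<omega>), \<theta> t \<omega>) \<partial>\<xi> (\<theta> t \<omega>)) * indicator B' t \<partial>\<eta> \<omega>)"
    proof (rule nn_integral_cong)
      fix t
      \<comment> \<open>Membership in the cell of the origin is exactly the condition under which
        \<open>F\<close> with target \<open>0\<close> is given by \<open>h\<close>; the flow at time
        \<open>0\<close> is the identity.\<close>
      have cell: "h (\<theta> s (\<theta> t \<omega>), \<theta> t \<omega>) * indicator (allocation_cell \<tau> (\<theta> t \<omega>) 0) s = F (\<theta> t \<omega>) s 0" for s
        by (simp add: F_def allocation_cell_def indicator_def)
      have [measurable]: "(\<lambda>_. \<theta> t \<omega>) \<in> M \<rightarrow>\<^sub>M P" for M :: "'g measure" by simp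
      \<comment> \<open>Invariance of \<xi> replaces \<open>s\<close> by \<open>s - t\<close>; the
        diagonal invariance of \<open>F\<close> with shift \<open>t\<close> then brings the target
        from \<open>0\<close> back to \<open>t\<close>.\<close>
      have "(\<integral>\<^sup>+s. F (\<theta> t \<omega>) s 0 \<partial>\<xi> (\<theta> t \<omega>)) = (\<integral>\<^sup>+s. F (\<theta> t \<omega>) (s - t) 0 \<partial>\<xi> \<omega>)"
        by (rule nn_integral_invariant[OF \<xi> \<omega>]) measurable
      also have "\<dots> = (\<integral>\<^sup>+s. F \<omega> s t \<partial>\<xi> \<omega>)"
        using F_inv[OF \<omega>, of t _ t] by simp
      finally have eq: "(\<integral>\<^sup>+s. F (\<theta> t \<omega>) s 0 \<partial>\<xi> (\<theta> t \<omega>)) = (\<integral>\<^sup>+s. F \<omega> s t \<partial>\<xi> \<omega>)" .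
      have "(\<lambda>s. F \<omega> s t) \<in> borel_measurable (\<xi> \<omega>)"
        by (subst measurable_cong_sets[OF random_measure_sets[OF \<xi>(1) \<omega>] refl]) measurable
      then show "(\<integral>\<^sup>+s. indicator B' t * F \<omega> s t \<partial>\<xi> \<omega>)
        = (\<integral>\<^sup>+s\<in>allocation_cell \<tau> (\<theta> t \<omega>) 0. h (\<theta> s (\<theta> t \<omega>), \<theta> t \<omega>) \<partial>\<xi> (\<theta> t \<omega>)) * indicator B' t"
        unfolding cell eq by (subst nn_integral_cmult) (simp_all only: mult.commute)
    qed
    finally show "(\<integral>\<^sup>+s. \<integral>\<^sup>+t. indicator B' t * F \<omega> s t \<partial>\<eta> \<omega> \<partial>\<xi> \<omega>) = \<dots>" .
  qed
  also have "inverse (emeasure \<nu> B') * \<dots>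
    = (\<integral>\<^sup>+\<omega>. (\<integral>\<^sup>+s\<in>allocation_cell \<tau> \<omega> 0. h (\<theta> s \<omega>, \<omega>) \<partial>\<xi> \<omega>) \<partial>palm_measure P \<theta> \<nu> B' \<eta>)"
  proof (rule nn_integral_palm_measure[OF \<eta>(1) assms(17), symmetric])
    \<comment> \<open>Writing the cell integral through \<open>F\<close> yields its measurability in
      \<omega> from that of the kernel.\<close>
    have "(\<lambda>\<omega>. \<integral>\<^sup>+s. F \<omega> s 0 \<partial>\<xi> \<omega>) \<in> borel_measurable P" by measurable
    also have "?this \<longleftrightarrow> (\<lambda>\<omega>. \<integral>\<^sup>+s\<in>allocation_cell \<tau> \<omega> 0. h (\<theta> s \<omega>, \<omega>) \<partial>\<xi> \<omega>) \<in> borel_measurable P"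
      by (intro measurable_cong nn_integral_cong) (simp add: F_def allocation_cell_def indicator_def)
    finally show "(\<lambda>\<omega>. \<integral>\<^sup>+s\<in>allocation_cell \<tau> \<omega> 0. h (\<theta> s \<omega>, \<omega>) \<partial>\<xi> \<omega>) \<in> borel_measurable P" .
  qed
  finally show ?thesis .
qed

end
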